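(* Let $K(n,p)$ and its Rees quotient $RIC_n(p)=K(n,p)/K(n,p-1)$ be as defined in the context, where $1\le p\le n$. Then $\mathrm{rank}\,K(n,p)=\mathrm{rank}\,RIC_n(p)$.
   Context: Let $n$ be a natural number and $[n]=\{1,2,\ldots,n\}$ with its usual order. $\mathcal{IC}_n$ is the monoid of all injective partial transformations $\alpha$ of $[n]$ (the empty map allowed) that are isotone ($x\le y$ implies $x\alpha\le y\alpha$ for all $x,y\in\mathrm{Dom}\,\alpha$) and order-decreasing ($x\alpha\le x$ for all $x\in \mathrm{Dom}\,\alpha$), maps being written on the right and composed left to right: $x(\alpha\beta)=(x\alpha)\beta$. For $1\le p\le n$, $K(n,p)=\{\alpha\in\mathcal{IC}_n:|\mathrm{Im}\,\alpha|\le p\}$ is a two-sided ideal of $\mathcal{IC}_n$ ($K(n,0)$ consists of the empty map). The Rees quotient $RIC_n(p)=K(n,p)/K(n,p-1)$ can be viewed as the set of elements of $\mathcal{IC}_n$ of height $|\mathrm{Im}\,\alpha|=p$ together with a zero $0$, where a product is $0$ whenever the product in $\mathcal{IC}_n$ has height less than $p$. The rank of a finite semigroup $S$ is $\min\{|A|: A\subseteq S,\ \langle A\rangle=S\}$, where $\langle A\rangle$ is the subsemigroup generated by $A$.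
   Formalization: The case p = n ≥ 2 is excluded because the claim is false there: RIC_n(n) = {identity, 0} has rank 2, while any generating set of K(n,n) = IC_n needs the identity and all n partial identities of height n−1, so its rank is at least n+1 ≥ 3. *)

theory Defs
  imports Main
begin

text \<open>
  A semigroup is a carrier together with a binary operation \<open>m\<close> on the ambient type.
\<close>

inductive_set subsemigroup_gen :: "('a \<Rightarrow> 'a \<Rightarrow> 'a) \<Rightarrow> 'a set \<Rightarrow> 'a set"
  for m :: "'a \<Rightarrow> 'a \<Rightarrow> 'a" and A :: "'a set" where
  gen_base: "a \<in> A \<Longrightarrow> a \<in> subsemigroup_gen m A"
| gen_mult: "a \<in> subsemigroup_gen m A \<Longrightarrow> b \<in> subsemigroup_gen m A \<Longrightarrow> m a b \<in> subsemigroup_gen m A"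

text \<open>Meaningful for finite \<open>S\<close>, where \<open>A = S\<close> witnesses that the minimum exists.\<close>

definition semigroup_rank :: "('a \<Rightarrow> 'a \<Rightarrow> 'a) \<Rightarrow> 'a set \<Rightarrow> nat" where
  "semigroup_rank m S =
     (LEAST k. \<exists>A. A \<subseteq> S \<and> finite A \<and> subsemigroup_gen m A = S \<and> card A = k)"

text \<open>
  The Rees quotient of \<open>S\<close> by an ideal \<open>I\<close>: the elements of \<open>S - I\<close> (tagged with \<^const>\<open>Some\<close>)
  together with the class of \<open>I\<close>, which is the zero \<^const>\<open>None\<close>.
\<close>

definition rees_carrier :: "'a set \<Rightarrow> 'a set \<Rightarrow> 'a option set" where
  "rees_carrier S I = insert None (Some ` (S - I))"

definition rees_mult :: "('a \<Rightarrow> 'a \<Rightarrow> 'a) \<Rightarrow> 'a set \<Rightarrow> 'a option \<Rightarrow> 'a option \<Rightarrow> 'a option" where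
  "rees_mult m I x y =
     (case (x, y) of
        (Some a, Some b) \<Rightarrow> (if m a b \<in> I then None else Some (m a b))
      | _ \<Rightarrow> None)"

text \<open>Partial maps act on the right and are composed from left to right.\<close>

definition pcomp :: "(nat \<rightharpoonup> nat) \<Rightarrow> (nat \<rightharpoonup> nat) \<Rightarrow> (nat \<rightharpoonup> nat)" where
  "pcomp \<alpha> \<beta> = \<beta> \<circ>\<^sub>m \<alpha>"

definition IC :: "nat \<Rightarrow> (nat \<rightharpoonup> nat) set" where
  "IC n = {\<alpha>. dom \<alpha> \<subseteq> {1..n} \<and> ran \<alpha> \<subseteq> {1..n} \<and> inj_on \<alpha> (dom \<alpha>) \<and>
              (\<forall>x\<in>dom \<alpha>. \<forall>y\<in>dom \<alpha>. x \<le> y \<longrightarrow> the (\<alpha> x) \<le> the (\<alpha> y)) \<and>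
              (\<forall>x\<in>dom \<alpha>. the (\<alpha> x) \<le> x)}"

definition K :: "nat \<Rightarrow> nat \<Rightarrow> (nat \<rightharpoonup> nat) set" where
  "K n p = {\<alpha> \<in> IC n. card (ran \<alpha>) \<le> p}"

definition RIC :: "nat \<Rightarrow> nat \<Rightarrow> (nat \<rightharpoonup> nat) option set" where
  "RIC n p = rees_carrier (K n p) (K n (p - 1))"

definition RIC_mult :: "nat \<Rightarrow> nat \<Rightarrow>
    (nat \<rightharpoonup> nat) option \<Rightarrow> (nat \<rightharpoonup> nat) option \<Rightarrow> (nat \<rightharpoonup> nat) option" where
  "RIC_mult n p = rees_mult pcomp (K n (p - 1))"

text \<open>
  For \<open>p = n \<ge> 2\<close> the ranks of \<open>K n p\<close> and \<open>RIC n p\<close> differ: \<open>RIC n n\<close> consists of the identity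
  and a zero, so it has rank 2, whereas every generating set of \<open>K n n = IC n\<close> contains the
  identity and the \<open>n\<close> partial identities of height \<open>n - 1\<close>.  The theorem therefore assumes
  \<open>p < n \<or> n = 1\<close> in addition to \<open>1 \<le> p \<le> n\<close>.
\<close>

end

theory Submission
  imports Defs
begin

text \<open>
  The quotient map \<open>K n p \<rightarrow> RIC n p\<close> is a surjective homomorphism, so it carries generating sets
  to generating sets and the rank cannot increase.  Conversely, a product in the Rees quotient is
  nonzero only if it is the same product of maps of height \<open>p\<close>, so the nonzero part of a generating
  set of \<open>RIC n p\<close> generates all maps of height \<open>p\<close>; it remains to see that, for \<open>p < n\<close>, these
  generate \<open>K n p\<close>.  By downward induction on the height it suffices to write a map of height
  \<open>q < n - 1\<close> with maps of height \<open>q + 1\<close>.  A partial identity on \<open>A\<close> is the product of those on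
  \<open>A \<union> {x}\<close> and \<open>A \<union> {y}\<close>.  Any other map is \<open>\<beta> \<mu>\<close>, where \<open>\<beta>\<close> moves one point one step less and
  \<open>\<mu>\<close> makes up for that step; as \<open>\<mu>\<close> involves only \<open>q + 1\<close> points, it can be enlarged by a fixed
  point outside the image of \<open>\<beta>\<close>.  If \<open>n = p = 1\<close>, only the empty map is collapsed and the quotient map is an
  isomorphism.
\<close>

section \<open>Generated subsemigroups, homomorphic images and rank\<close>

lemma subsemigroup_gen_subset:
  assumes "A \<subseteq> S" and "\<And>a b. a \<in> S \<Longrightarrow> b \<in> S \<Longrightarrow> m a b \<in> S"
  shows "subsemigroup_gen m A \<subseteq> S"
proof
  fix x assume "x \<in> subsemigroup_gen m A"
  then show "x \<in> S" by induction (use assms in auto)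
qed

lemma subsemigroup_gen_closed_eq:
  assumes "\<And>a b. a \<in> S \<Longrightarrow> b \<in> S \<Longrightarrow> m a b \<in> S"
  shows "subsemigroup_gen m S = S"
proof
  show "subsemigroup_gen m S \<subseteq> S" by (rule subsemigroup_gen_subset[OF order_refl assms])
qed (auto intro: gen_base)

text \<open>Both inclusions are inductions on generation. Closure of \<open>S\<close> and
  \<open>A \<subseteq> S\<close> keep every generated element in \<open>S\<close>, where
  \<open>hom\<close> is available.\<close>

lemma subsemigroup_gen_image:
  assumes closed: "\<And>a b. a \<in> S \<Longrightarrow> b \<in> S \<Longrightarrow> m a b \<in> S"
    and hom: "\<And>a b. a \<in> S \<Longrightarrow> b \<in> S \<Longrightarrow> f (m a b) = m' (f a) (f b)"
    and "A \<subseteq> S"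
  shows "subsemigroup_gen m' (f ` A) = f ` subsemigroup_gen m A"
proof -
  have sub: "subsemigroup_gen m A \<subseteq> S"
    by (rule subsemigroup_gen_subset[OF \<open>A \<subseteq> S\<close> closed])
  have "f x \<in> subsemigroup_gen m' (f ` A)" if "x \<in> subsemigroup_gen m A" for x
    using that
  proof induction
    case (gen_mult a b)
    then have "f (m a b) = m' (f a) (f b)" using sub hom by blast
    then show ?case using subsemigroup_gen.gen_mult[OF gen_mult.IH] by simp
  qed (auto intro: gen_base)
  moreover have "y \<in> f ` subsemigroup_gen m A" if "y \<in> subsemigroup_gen m' (f ` A)" for y
    using that
  proof induction
    case (gen_mult y z)
    then obtain a b where "a \<in> subsemigroup_gen m A" "b \<in> subsemigroup_gen m A" "y = f a" "z = f b"
      by blast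
    moreover from this have "f (m a b) = m' (f a) (f b)" using sub hom by blast
    ultimately show ?case by (metis imageI subsemigroup_gen.gen_mult)
  qed (auto intro: gen_base)
  ultimately show ?thesis by blast
qed

text \<open>Finiteness and closure make \<open>S\<close> a generating set of itself, so the minimum
  in \<open>semigroup_rank\<close> is attained; \<open>step\<close> turns a smallest generating set
  of \<open>S\<close> into one of \<open>T\<close> that is no larger.\<close>

lemma semigroup_rank_leI:
  assumes "finite S" and "\<And>a b. a \<in> S \<Longrightarrow> b \<in> S \<Longrightarrow> m a b \<in> S"
    and step: "\<And>A. A \<subseteq> S \<Longrightarrow> subsemigroup_gen m A = S \<Longrightarrow>
      \<exists>B. B \<subseteq> T \<and> finite B \<and> subsemigroup_gen m' B = T \<and> card B \<le> card A"
  shows "semigroup_rank m' T \<le> semigroup_rank m S"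
proof -
  have "\<exists>A. A \<subseteq> S \<and> finite A \<and> subsemigroup_gen m A = S \<and> card A = card S"
    using assms(1) subsemigroup_gen_closed_eq[of S m, OF assms(2)] by blast
  then have "\<exists>A. A \<subseteq> S \<and> finite A \<and> subsemigroup_gen m A = S \<and> card A = semigroup_rank m S"
    unfolding semigroup_rank_def by (rule LeastI)
  then obtain A where "A \<subseteq> S" "subsemigroup_gen m A = S" "card A = semigroup_rank m S"
    by blast
  with step obtain B where "B \<subseteq> T" "finite B" "subsemigroup_gen m' B = T"
    and le: "card B \<le> semigroup_rank m S"
    by metis
  then have "semigroup_rank m' T \<le> card B"
    unfolding semigroup_rank_def by (intro Least_le) blast
  with le show ?thesis by simp
qed

lemma semigroup_rank_hom_le:
  assumes "finite S" and closed: "\<And>a b. a \<in> S \<Longrightarrow> b \<in> S \<Longrightarrow> m a b \<in> S"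
    and hom: "\<And>a b. a \<in> S \<Longrightarrow> b \<in> S \<Longrightarrow> f (m a b) = m' (f a) (f b)"
  shows "semigroup_rank m' (f ` S) \<le> semigroup_rank m S"
proof (rule semigroup_rank_leI[OF \<open>finite S\<close> closed])
  fix A assume A: "A \<subseteq> S" "subsemigroup_gen m A = S"
  have "subsemigroup_gen m' (f ` A) = f ` S"
    using subsemigroup_gen_image[of S m f m' A, OF closed hom A(1)] A(2) by simp
  then show "\<exists>B. B \<subseteq> f ` S \<and> finite B \<and> subsemigroup_gen m' B = f ` S \<and> card B \<le> card A"
    using A(1) finite_subset[OF A(1) \<open>finite S\<close>]
    by (intro exI[of _ "f ` A"]) (auto simp: card_image_le)
qed

section \<open>Rees quotients\<close>

lemma rees_carrier_closed:
  assumes "\<And>a b. a \<in> S \<Longrightarrow> b \<in> S \<Longrightarrow> m a b \<in> S"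
    and "x \<in> rees_carrier S I" "y \<in> rees_carrier S I"
  shows "rees_mult m I x y \<in> rees_carrier S I"
  using assms(2,3)
  by (auto simp: rees_carrier_def rees_mult_def assms(1) split: if_splits)

text \<open>The quotient map \<open>f\<close> is a homomorphism because \<open>I\<close> is a
  two-sided ideal. It reaches \<open>None\<close>, which \<open>rees_carrier\<close> always
  contains, because \<open>I\<close> is nonempty.\<close>

lemma semigroup_rank_rees_le:
  assumes "finite S" and "\<And>a b. a \<in> S \<Longrightarrow> b \<in> S \<Longrightarrow> m a b \<in> S"
    and "I \<subseteq> S" "I \<noteq> {}"
    and "\<And>a b. a \<in> I \<Longrightarrow> b \<in> S \<Longrightarrow> m a b \<in> I" "\<And>a b. a \<in> S \<Longrightarrow> b \<in> I \<Longrightarrow> m a b \<in> I"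
  shows "semigroup_rank (rees_mult m I) (rees_carrier S I) \<le> semigroup_rank m S"
proof -
  define f where "f = (\<lambda>a. if a \<in> I then None else Some a)"
  have "rees_carrier S I = f ` S"
    using assms(3,4) by (auto simp: rees_carrier_def f_def image_iff)
  moreover have "f (m a b) = rees_mult m I (f a) (f b)" if "a \<in> S" "b \<in> S" for a b
    using that assms(5,6) by (auto simp: rees_mult_def f_def)
  ultimately show ?thesis
    using semigroup_rank_hom_le[of S m f "rees_mult m I"] assms(1,2) by simp
qed

text \<open>A product with value \<open>Some _\<close> has two factors of that form and is computed
  by \<open>m\<close>, so the zero never enters its factorisation.\<close>

lemma subsemigroup_gen_rees_SomeD:
  assumes "Some a \<in> subsemigroup_gen (rees_mult m I) A"
  shows "a \<in> subsemigroup_gen m {a. Some a \<in> A}"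
proof -
  have "\<forall>a. x = Some a \<longrightarrow> a \<in> subsemigroup_gen m {a. Some a \<in> A}"
    if "x \<in> subsemigroup_gen (rees_mult m I) A" for x
    using that
  proof induction
    case (gen_mult x y)
    then show ?case
      by (auto simp: rees_mult_def intro: subsemigroup_gen.gen_mult split: option.splits if_splits)
  qed (auto intro: gen_base)
  with assms show ?thesis by blast
qed

section \<open>The monoid of isotone, order-decreasing partial injections and its ideals\<close>

lemma IC_iff:
  "\<alpha> \<in> IC n \<longleftrightarrow> (\<forall>x y. \<alpha> x = Some y \<longrightarrow> 1 \<le> y \<and> y \<le> x \<and> x \<le> n) \<and>
     (\<forall>x y x' y'. \<alpha> x = Some y \<longrightarrow> \<alpha> x' = Some y' \<longrightarrow> x < x' \<longrightarrow> y < y')"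
  (is "_ \<longleftrightarrow> ?bounds \<and> ?mono")
proof
  assume "\<alpha> \<in> IC n"
  then have d: "dom \<alpha> \<subseteq> {1..n}" "ran \<alpha> \<subseteq> {1..n}" and inj: "inj_on \<alpha> (dom \<alpha>)"
    and iso: "\<And>x y. x \<in> dom \<alpha> \<Longrightarrow> y \<in> dom \<alpha> \<Longrightarrow> x \<le> y \<Longrightarrow> the (\<alpha> x) \<le> the (\<alpha> y)"
    and dec: "\<And>x. x \<in> dom \<alpha> \<Longrightarrow> the (\<alpha> x) \<le> x"
    by (auto simp: IC_def)
  have ?bounds
  proof (intro allI impI)
    fix x y assume "\<alpha> x = Some y"
    then have "x \<in> dom \<alpha>" "y \<in> ran \<alpha>" by (auto simp: ran_def)
    with d dec[of x] \<open>\<alpha> x = Some y\<close> show "1 \<le> y \<and> y \<le> x \<and> x \<le> n" by auto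
  qed
  moreover have ?mono
  proof (intro allI impI)
    fix x y x' y' assume h: "\<alpha> x = Some y" "\<alpha> x' = Some y'" "x < x'"
    then have "y \<le> y'" using iso[of x x'] by (auto simp: dom_def)
    moreover have "y \<noteq> y'" using h inj_onD[OF inj, of x x'] by auto
    ultimately show "y < y'" by simp
  qed
  ultimately show "?bounds \<and> ?mono" by blast
next
  assume h: "?bounds \<and> ?mono"
  then have b: "\<And>x y. \<alpha> x = Some y \<Longrightarrow> 1 \<le> y \<and> y \<le> x \<and> x \<le> n"
    and s: "\<And>x y x' y'. \<alpha> x = Some y \<Longrightarrow> \<alpha> x' = Some y' \<Longrightarrow> x < x' \<Longrightarrow> y < y'"
    by blast+
  have "inj_on \<alpha> (dom \<alpha>)"
  proof (rule inj_onI)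
    fix x x' assume "x \<in> dom \<alpha>" "\<alpha> x = \<alpha> x'"
    then obtain y where "\<alpha> x = Some y" "\<alpha> x' = Some y" by (metis domD)
    then show "x = x'" using s[of x y x' y] s[of x' y x y] by (cases x x' rule: linorder_cases) auto
  qed
  moreover have "the (\<alpha> x) \<le> the (\<alpha> y)" if "x \<in> dom \<alpha>" "y \<in> dom \<alpha>" "x \<le> y" for x y
    using that s[of x _ y] by (cases "x = y") (auto simp: order.strict_iff_order)
  moreover have "dom \<alpha> \<subseteq> {1..n}" "ran \<alpha> \<subseteq> {1..n}"
    using b by (fastforce simp: dom_def ran_def)+
  ultimately show "\<alpha> \<in> IC n"
    using b by (auto simp: IC_def)
qed

lemma IC_D:
  assumes "\<alpha> \<in> IC n"
  shows "\<alpha> x = Some y \<Longrightarrow> 1 \<le> y" "\<alpha> x = Some y \<Longrightarrow> y \<le> x" "\<alpha> x = Some y \<Longrightarrow> x \<le> n"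
    "\<alpha> x = Some y \<Longrightarrow> \<alpha> x' = Some y' \<Longrightarrow> x < x' \<Longrightarrow> y < y'"
  using assms unfolding IC_iff by blast+

lemma IC_dom_ran:
  assumes "\<alpha> \<in> IC n"
  shows "dom \<alpha> \<subseteq> {1..n}" "ran \<alpha> \<subseteq> {1..n}" "finite (dom \<alpha>)" "finite (ran \<alpha>)"
  using assms by (auto simp: IC_def intro: finite_subset)

text \<open>Allows height to be counted on the domain, as the factorisation arguments do.\<close>

lemma card_ran_IC:
  assumes "\<alpha> \<in> IC n"
  shows "card (ran \<alpha>) = card (dom \<alpha>)"
proof -
  have "inj_on (the \<circ> \<alpha>) (dom \<alpha>)"
    using assms by (intro comp_inj_on) (auto simp: IC_def inj_on_def)
  moreover have "ran \<alpha> = (the \<circ> \<alpha>) ` dom \<alpha>"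
    by (force simp: ran_def dom_def)
  ultimately show ?thesis by (simp only: card_image)
qed

lemma pcomp_eq_Some_iff: "pcomp \<alpha> \<beta> x = Some z \<longleftrightarrow> (\<exists>y. \<alpha> x = Some y \<and> \<beta> y = Some z)"
  by (auto simp: pcomp_def map_comp_Some_iff)

lemma pcomp_IC:
  assumes "\<alpha> \<in> IC n" "\<beta> \<in> IC n"
  shows "pcomp \<alpha> \<beta> \<in> IC n"
  unfolding IC_iff
proof (intro conjI allI impI)
  fix x z assume "pcomp \<alpha> \<beta> x = Some z"
  then obtain y where "\<alpha> x = Some y" "\<beta> y = Some z" by (auto simp: pcomp_eq_Some_iff)
  then show "1 \<le> z" "z \<le> x" "x \<le> n"
    using IC_D[OF assms(1), of x y] IC_D[OF assms(2), of y z] by auto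
next
  fix x z x' z' assume "pcomp \<alpha> \<beta> x = Some z" "pcomp \<alpha> \<beta> x' = Some z'" "x < x'"
  then show "z < z'"
    using IC_D(4)[OF assms(1)] IC_D(4)[OF assms(2)] unfolding pcomp_eq_Some_iff by blast
qed

lemma finite_IC: "finite (IC n)"
proof (rule finite_subset)
  show "IC n \<subseteq> (\<Union>D\<in>Pow {1..n}. {\<alpha>. dom \<alpha> = D \<and> ran \<alpha> \<subseteq> {1..n}})"
    by (auto simp: IC_def)
  show "finite (\<Union>D\<in>Pow {1..n}. {\<alpha> :: nat \<rightharpoonup> nat. dom \<alpha> = D \<and> ran \<alpha> \<subseteq> {1..n}})"
    by (intro finite_UN_I finite_set_of_finite_maps) (auto intro: finite_subset)
qed

lemma card_ran_pcomp_le: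
  assumes "\<alpha> \<in> IC n" "\<beta> \<in> IC n"
  shows "card (ran (pcomp \<alpha> \<beta>)) \<le> card (ran \<alpha>)" "card (ran (pcomp \<alpha> \<beta>)) \<le> card (ran \<beta>)"
proof -
  have "dom (pcomp \<alpha> \<beta>) \<subseteq> dom \<alpha>" "ran (pcomp \<alpha> \<beta>) \<subseteq> ran \<beta>"
    by (auto simp: dom_def ran_def pcomp_eq_Some_iff)
  then have "card (dom (pcomp \<alpha> \<beta>)) \<le> card (dom \<alpha>)"
    and "card (ran (pcomp \<alpha> \<beta>)) \<le> card (ran \<beta>)"
    using assms by (auto intro: card_mono IC_dom_ran)
  then show "card (ran (pcomp \<alpha> \<beta>)) \<le> card (ran \<alpha>)" "card (ran (pcomp \<alpha> \<beta>)) \<le> card (ran \<beta>)"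
    using card_ran_IC[OF assms(1)] card_ran_IC[OF pcomp_IC[OF assms]] by simp_all
qed

lemma K_ideal:
  assumes "\<alpha> \<in> IC n" "\<beta> \<in> IC n" and "\<alpha> \<in> K n p \<or> \<beta> \<in> K n p"
  shows "pcomp \<alpha> \<beta> \<in> K n p"
  using assms card_ran_pcomp_le[OF assms(1,2)] pcomp_IC[OF assms(1,2)]
  by (auto simp: K_def)

lemma K_closed: "\<alpha> \<in> K n p \<Longrightarrow> \<beta> \<in> K n p \<Longrightarrow> pcomp \<alpha> \<beta> \<in> K n p"
  by (rule K_ideal) (auto simp: K_def)

lemma finite_K: "finite (K n p)"
  by (rule finite_subset[OF _ finite_IC[of n]]) (auto simp: K_def)

section \<open>Factorisation into maps of greater height\<close>

lemma restrict_Some_IC: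
  assumes "A \<subseteq> {1..n}"
  shows "Some |` A \<in> IC n"
  using assms by (auto simp: IC_iff restrict_map_def split: if_splits)

text \<open>Induction on the total displacement, the sum of \<open>x - the (\<alpha> x)\<close>.
  Partial identities are factored directly; otherwise \<open>\<alpha>\<close> is
  \<open>pcomp \<beta> \<mu>\<close>, with \<open>\<beta>\<close> of the same height and smaller
  displacement, and \<open>\<mu>\<close> of height \<open>Suc q\<close>. The set \<open>G\<close>
  will be a generated subsemigroup.\<close>

lemma IC_factor_higher:
  assumes "\<alpha> \<in> IC n" "card (dom \<alpha>) = q" "Suc q < n"
    and closed: "\<And>\<beta> \<gamma>. \<beta> \<in> G \<Longrightarrow> \<gamma> \<in> G \<Longrightarrow> pcomp \<beta> \<gamma> \<in> G"
    and high: "\<And>\<beta>. \<beta> \<in> IC n \<Longrightarrow> card (dom \<beta>) = Suc q \<Longrightarrow> \<beta> \<in> G"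
  shows "\<alpha> \<in> G"
  using assms(1,2)
proof (induction "\<Sum>x\<in>dom \<alpha>. x - the (\<alpha> x)" arbitrary: \<alpha> rule: less_induct)
  case less
  note \<alpha> = \<open>\<alpha> \<in> IC n\<close>
  note ds = IC_dom_ran[OF \<alpha>]
  \<comment> \<open>Pigeonhole: since \<open>Suc q < n\<close>, any \<open>Suc q\<close> points
    leave a point of \<open>{1..n}\<close> free.\<close>
  have missing: thesis
    if "finite B" "card B \<le> Suc q" "\<And>c. c \<in> {1..n} \<Longrightarrow> c \<notin> B \<Longrightarrow> thesis" for B thesis
  proof -
    have "\<not> {1..n} \<subseteq> B"
    proof
      assume "{1..n} \<subseteq> B"
      then have "card {1..n} \<le> card B" using that(1) by (intro card_mono)
      with that(2) \<open>Suc q < n\<close> show False by simp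
    qed
    with that(3) show thesis by blast
  qed
  show ?case
  proof (cases "\<exists>x y. \<alpha> x = Some y \<and> y < x")
    case False
    let ?A = "dom \<alpha>"
    have id: "\<alpha> = Some |` ?A"
    proof
      fix x show "\<alpha> x = (Some |` ?A) x"
        using False IC_D(2)[OF \<alpha>, of x] by (cases "\<alpha> x") (fastforce simp: restrict_map_def)+
    qed
    obtain c where c: "c \<in> {1..n}" "c \<notin> ?A"
      by (rule missing[of ?A]) (use ds(3) less.prems(2) in auto)
    obtain d where d: "d \<in> {1..n}" "d \<notin> insert c ?A"
      by (rule missing[of "insert c ?A"]) (use ds(3) less.prems(2) c(2) in auto)
    have "Some |` insert c ?A \<in> G"
      using c ds less.prems(2) by (intro high restrict_Some_IC) auto
    moreover have "Some |` insert d ?A \<in> G"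
      using d ds less.prems(2) by (intro high restrict_Some_IC) auto
    moreover have "pcomp (Some |` insert c ?A) (Some |` insert d ?A) = Some |` ?A"
      using c(2) d(2) by (auto simp: fun_eq_iff pcomp_def map_comp_def restrict_map_def)
    then have "pcomp (Some |` insert c ?A) (Some |` insert d ?A) = \<alpha>"
      using id by (rule trans[OF _ sym])
    ultimately show ?thesis using closed by force
  next
    case True
    \<comment> \<open>The point to adjust is the largest moved one, \<open>x\<close>. Domain points
      above it are fixed, so their images exceed \<open>x \<ge> Suc y\<close>; those below it have
      images below \<open>y\<close>. Hence \<open>Suc y\<close> is a free value for
      \<open>x\<close>.\<close>
    define M where "M = {x. \<exists>y. \<alpha> x = Some y \<and> y < x}"
    have "finite M" using ds(3) by (rule rev_finite_subset) (auto simp: M_def)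
    moreover have "M \<noteq> {}" using True by (auto simp: M_def)
    ultimately have "Max M \<in> M" and above: "\<And>x. x \<in> M \<Longrightarrow> x \<le> Max M"
      by (auto intro: Max_in)
    define x where "x = Max M"
    obtain y where xy: "\<alpha> x = Some y" "y < x"
      using \<open>Max M \<in> M\<close> by (auto simp: M_def x_def)
    have fixed: "z = w" if "\<alpha> z = Some w" "x < z" for z w
      using that above[of z] IC_D(2)[OF \<alpha>, of z w] by (force simp: M_def x_def)
    have yran: "y \<in> ran \<alpha>" using xy by (auto simp: ran_def)
    have y1: "w \<noteq> Suc y" if "\<alpha> z = Some w" "z \<noteq> x" for z w
      using that xy fixed[of z w] IC_D(4)[OF \<alpha>, of z w x y]
      by (cases z x rule: linorder_cases) auto
    have y0: "w \<noteq> y" if "\<alpha> z = Some w" "z \<noteq> x" for z w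
      using that xy fixed[of z w] IC_D(4)[OF \<alpha>, of z w x y]
      by (cases z x rule: linorder_cases) auto
    define \<beta> where "\<beta> = \<alpha>(x \<mapsto> Suc y)"
    have dom\<beta>: "dom \<beta> = dom \<alpha>" using xy by (auto simp: \<beta>_def)
    have \<beta>: "\<beta> \<in> IC n"
      unfolding IC_iff
    proof (intro conjI allI impI)
      fix z w assume "\<beta> z = Some w"
      then show "1 \<le> w" "w \<le> z" "z \<le> n"
        using IC_D(1-3)[OF \<alpha>, of z] xy by (auto simp: \<beta>_def split: if_splits)
    next
      fix z w z' w' assume h: "\<beta> z = Some w" "\<beta> z' = Some w'" "z < z'"
      show "w < w'"
      proof (cases "z = x")
        case True
        then show ?thesis using h xy fixed[of z' w'] by (auto simp: \<beta>_def)
      next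
        case False
        then show ?thesis
          using h xy IC_D(4)[OF \<alpha>, of z w z'] by (auto simp: \<beta>_def split: if_splits)
      qed
    qed
    \<comment> \<open>Only the summand at \<open>x\<close> changes; as \<open>y < x\<close>,
      truncated subtraction really drops from \<open>x - y\<close> to
      \<open>x - Suc y\<close>.\<close>
    have "(\<Sum>z\<in>dom \<beta>. z - the (\<beta> z)) < (\<Sum>z\<in>dom \<alpha>. z - the (\<alpha> z))"
      unfolding dom\<beta>
    proof (rule sum_strict_mono_ex1[OF ds(3)])
      show "\<forall>z\<in>dom \<alpha>. z - the (\<beta> z) \<le> z - the (\<alpha> z)" using xy by (auto simp: \<beta>_def)
      show "\<exists>z\<in>dom \<alpha>. z - the (\<beta> z) < z - the (\<alpha> z)"
        using xy by (intro bexI[of _ x]) (auto simp: \<beta>_def)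
    qed
    then have \<beta>G: "\<beta> \<in> G" using less.hyps[of \<beta>] \<beta> dom\<beta> less.prems(2) by simp
    \<comment> \<open>The images of the points other than \<open>x\<close>, common to
      \<open>\<alpha>\<close> and \<open>\<beta>\<close>; \<open>\<mu>\<close> has to fix
      them.\<close>
    define R where "R = ran \<alpha> - {y}"
    have R: "finite R" "card (insert y R) = q" "y \<notin> R" "R \<subseteq> {1..n}"
      using ds yran less.prems(2) card_ran_IC[OF \<alpha>] by (auto simp: R_def insert_absorb)
    have y1R: "Suc y \<notin> R"
      using y1 xy by (fastforce simp: R_def ran_def)
    \<comment> \<open>Avoiding \<open>R\<close> and \<open>Suc y\<close> makes the domain of
      \<open>\<mu>\<close> have \<open>(q - 1) + 2\<close> points; avoiding \<open>y\<close> keeps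
      \<open>\<mu>\<close> injective, as \<open>Suc y\<close> is sent to \<open>y\<close>.\<close>
    obtain c where c: "c \<in> {1..n}" "c \<notin> insert (Suc y) (insert y R)"
      by (rule missing[of "insert (Suc y) (insert y R)"])
        (use R(1,2) in \<open>simp_all add: card_insert_if\<close>)
    define \<mu> where "\<mu> = (Some |` insert c R)(Suc y \<mapsto> y)"
    have "dom \<mu> = insert (Suc y) (insert c R)" by (auto simp: \<mu>_def)
    then have "card (dom \<mu>) = Suc q"
      using R c y1R by simp
    moreover have "\<mu> \<in> IC n"
      unfolding IC_iff
    proof (intro conjI allI impI)
      fix z w assume "\<mu> z = Some w"
      then show "1 \<le> w" "w \<le> z" "z \<le> n"
        using R(4) c(1) xy IC_D(1,3)[OF \<alpha> xy(1)]
        by (auto simp: \<mu>_def restrict_map_def split: if_splits)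
    next
      fix z w z' w' assume h: "\<mu> z = Some w" "\<mu> z' = Some w'" "z < z'"
      \<comment> \<open>With \<open>y\<close> outside the domain, any domain point below
        \<open>Suc y\<close> is below \<open>y\<close>, so the step down keeps the order
        strict.\<close>
      moreover have "y \<noteq> z" using h(1) c R(3) by (auto simp: \<mu>_def restrict_map_def split: if_splits)
      ultimately show "w < w'"
        by (auto simp: \<mu>_def restrict_map_def split: if_splits)
    qed
    ultimately have "\<mu> \<in> G" by (intro high)
    moreover have "pcomp \<beta> \<mu> = \<alpha>"
    proof
      fix z
      show "pcomp \<beta> \<mu> z = \<alpha> z"
      proof (cases "z = x")
        case True
        then show ?thesis using xy by (simp add: pcomp_def \<beta>_def \<mu>_def)
      next
        case False
        show ?thesis
        proof (cases "\<alpha> z")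
          case None
          then show ?thesis using False by (simp add: pcomp_def \<beta>_def map_comp_def)
        next
          case (Some w)
          then have "w \<in> R" using y0[OF Some False] by (auto simp: R_def ran_def)
          then show ?thesis using False Some y1R
            by (auto simp: pcomp_def \<beta>_def \<mu>_def map_comp_def restrict_map_def)
        qed
      qed
    qed
    ultimately show ?thesis using closed[OF \<beta>G] by force
  qed
qed

text \<open>Downward induction from height \<open>p\<close>: a step to height \<open>q\<close> has
  \<open>q < p < n\<close>, which supplies the bound \<open>Suc q < n\<close> of
  \<open>IC_factor_higher\<close>.\<close>

lemma K_subset_of_top_height:
  assumes "p < n"
    and closed: "\<And>\<beta> \<gamma>. \<beta> \<in> G \<Longrightarrow> \<gamma> \<in> G \<Longrightarrow> pcomp \<beta> \<gamma> \<in> G"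
    and top: "\<And>\<beta>. \<beta> \<in> IC n \<Longrightarrow> card (dom \<beta>) = p \<Longrightarrow> \<beta> \<in> G"
  shows "K n p \<subseteq> G"
proof
  fix \<alpha> assume "\<alpha> \<in> K n p"
  then have \<alpha>: "\<alpha> \<in> IC n" and "card (dom \<alpha>) \<le> p" by (auto simp: K_def card_ran_IC)
  from this(2) have "\<forall>\<beta>. \<beta> \<in> IC n \<longrightarrow> card (dom \<beta>) = card (dom \<alpha>) \<longrightarrow> \<beta> \<in> G"
  proof (induction rule: inc_induct)
    case base
    show ?case using top by blast
  next
    case (step q)
    show ?case
    proof (intro allI impI)
      fix \<beta> assume "\<beta> \<in> IC n" "card (dom \<beta>) = q"
      then show "\<beta> \<in> G"
        by (rule IC_factor_higher) (use step \<open>p < n\<close> closed in auto)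
    qed
  qed
  with \<alpha> show "\<alpha> \<in> G" by blast
qed

section \<open>The two rank inequalities\<close>

lemma K_0: "K n 0 = {Map.empty}"
proof -
  have "\<alpha> = Map.empty" if "\<alpha> \<in> K n 0" for \<alpha>
    using that IC_dom_ran(3)[of \<alpha> n] card_ran_IC[of \<alpha> n] by (auto simp: K_def)
  moreover have "Map.empty \<in> K n 0" by (auto simp: K_def IC_def)
  ultimately show ?thesis by blast
qed

lemma empty_in_K: "Map.empty \<in> K n p"
  using K_0[of n] by (auto simp: K_def)

text \<open>As \<open>K n 0\<close> holds only the empty map, the quotient merely renames it to
  \<open>None\<close>; \<open>g\<close> undoes the renaming and is a surjective
  homomorphism.\<close>

lemma rank_K_le_rank_RIC_1: "semigroup_rank pcomp (K n 1) \<le> semigroup_rank (RIC_mult n 1) (RIC n 1)"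
proof -
  define g :: "(nat \<rightharpoonup> nat) option \<Rightarrow> (nat \<rightharpoonup> nat)"
    where "g = case_option Map.empty id"
  have "K n 1 = g ` RIC n 1"
    using empty_in_K[of n 1] by (auto simp: RIC_def rees_carrier_def K_0 g_def image_image)
  moreover have "g (RIC_mult n 1 a b) = pcomp (g a) (g b)" for a b
    by (cases a; cases b)
      (auto simp: RIC_mult_def rees_mult_def K_0 g_def pcomp_def map_comp_def fun_eq_iff
        split: option.splits)
  moreover have "finite (RIC n 1)"
    using finite_K by (simp add: RIC_def rees_carrier_def)
  moreover have "RIC_mult n 1 a b \<in> RIC n 1" if "a \<in> RIC n 1" "b \<in> RIC n 1" for a b
    using that unfolding RIC_def RIC_mult_def by (intro rees_carrier_closed K_closed)
  ultimately show ?thesis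
    using semigroup_rank_hom_le[of "RIC n 1" "RIC_mult n 1" g pcomp] by simp
qed

lemma rank_K_le_rank_RIC:
  assumes "1 \<le> p" "p < n"
  shows "semigroup_rank pcomp (K n p) \<le> semigroup_rank (RIC_mult n p) (RIC n p)"
proof (rule semigroup_rank_leI)
  show fin: "finite (RIC n p)"
    using finite_K by (simp add: RIC_def rees_carrier_def)
  show "RIC_mult n p a b \<in> RIC n p" if "a \<in> RIC n p" "b \<in> RIC n p" for a b
    using that unfolding RIC_def RIC_mult_def by (intro rees_carrier_closed K_closed)
  fix A assume A: "A \<subseteq> RIC n p" "subsemigroup_gen (RIC_mult n p) A = RIC n p"
  \<comment> \<open>Dropping the zero and the tags does not increase the cardinality of
    \<open>A\<close>.\<close>
  define B where "B = {a. Some a \<in> A}"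
  have "B \<subseteq> K n p" using A(1) by (auto simp: B_def RIC_def rees_carrier_def)
  moreover have "finite B" using calculation finite_K finite_subset by blast
  moreover have "card B \<le> card A"
  proof -
    have "card (Some ` B) \<le> card A"
      using finite_subset[OF A(1) fin] by (intro card_mono) (auto simp: B_def)
    then show ?thesis by (simp add: card_image)
  qed
  moreover have "subsemigroup_gen pcomp B = K n p"
  proof
    show "subsemigroup_gen pcomp B \<subseteq> K n p"
      using \<open>B \<subseteq> K n p\<close> by (intro subsemigroup_gen_subset K_closed)
    show "K n p \<subseteq> subsemigroup_gen pcomp B"
    proof (rule K_subset_of_top_height[OF \<open>p < n\<close>])
      show "pcomp \<beta> \<gamma> \<in> subsemigroup_gen pcomp B"
        if "\<beta> \<in> subsemigroup_gen pcomp B" "\<gamma> \<in> subsemigroup_gen pcomp B" for \<beta> \<gamma>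
        using that by (rule gen_mult)
      fix \<beta> assume "\<beta> \<in> IC n" "card (dom \<beta>) = p"
      \<comment> \<open>Here \<open>1 \<le> p\<close> matters: height \<open>p\<close> must exceed
        the truncated difference \<open>p - 1\<close> for \<open>\<beta>\<close> to survive in the
        quotient.\<close>
      then have "Some \<beta> \<in> RIC n p"
        using \<open>1 \<le> p\<close> by (auto simp: RIC_def rees_carrier_def K_def card_ran_IC)
      then show "\<beta> \<in> subsemigroup_gen pcomp B"
        using A(2) unfolding B_def RIC_mult_def by (auto intro: subsemigroup_gen_rees_SomeD)
    qed
  qed
  ultimately show "\<exists>B. B \<subseteq> K n p \<and> finite B \<and> subsemigroup_gen pcomp B = K n p \<and> card B \<le> card A"
    by blast
qed

theorem theorem3p16:
  fixes n p :: nat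
  assumes "1 \<le> p" and "p \<le> n"
    and "p < n \<or> n = 1"
  shows "semigroup_rank pcomp (K n p) = semigroup_rank (RIC_mult n p) (RIC n p)"
proof (rule antisym)
  show "semigroup_rank pcomp (K n p) \<le> semigroup_rank (RIC_mult n p) (RIC n p)"
  proof (cases "p < n")
    case True
    with assms(1) show ?thesis by (rule rank_K_le_rank_RIC)
  next
    case False
    with assms have "p = 1" by simp
    then show ?thesis using rank_K_le_rank_RIC_1 by simp
  qed
  \<comment> \<open>This direction only uses that \<open>K n (p - 1)\<close> is a nonempty ideal: it
    contains the empty map, and heights cannot grow in products.\<close>
  show "semigroup_rank (RIC_mult n p) (RIC n p) \<le> semigroup_rank pcomp (K n p)"
    unfolding RIC_def RIC_mult_def
  proof (rule semigroup_rank_rees_le[OF finite_K K_closed])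
    show "K n (p - 1) \<subseteq> K n p" by (auto simp: K_def)
    show "K n (p - 1) \<noteq> {}" using empty_in_K by blast
    have "K n q \<subseteq> IC n" for q by (auto simp: K_def)
    then show "pcomp a b \<in> K n (p - 1)" if "a \<in> K n (p - 1)" "b \<in> K n p" for a b
      using that by (intro K_ideal) auto
    from \<open>\<And>q. K n q \<subseteq> IC n\<close> show "pcomp a b \<in> K n (p - 1)" if "a \<in> K n p" "b \<in> K n (p - 1)" for a b
      using that by (intro K_ideal) auto
  qed
qed

end
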